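(* Let $n\ge 1$ and let $e_1,\dots,e_n$ be the standard basis of $\mathbb{R}^n$. The real frame $\mathcal{F}_{\mathbb{R}}=\{e_1,\ldots,e_n\}\cup\{e_i+e_j\}_{1\le i<j\le n}$ in $\mathbb{R}^n$ is vital.
   Context: A frame in $\mathbb{R}^n$ is a finite set of vectors spanning $\mathbb{R}^n$. A finite set $\{v_i\}_{i=1}^m\subset\mathbb{R}^n$ permits phase retrieval if for all $\psi,\phi\in\mathbb{R}^n$, the equalities $|\langle v_i,\psi\rangle|^2=|\langle v_i,\phi\rangle|^2$ for all $i$ imply $\phi=\pm\psi$. A frame is vital if it permits phase retrieval, but removing any single vector from it yields a set that does not permit phase retrieval. *)

theory Defs
  imports "HOL-Analysis.Analysis"
begin

definition is_frame :: "(real ^ 'n) set \<Rightarrow> bool" where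
  "is_frame F \<longleftrightarrow> finite F \<and> span F = UNIV"

definition permits_phase_retrieval :: "(real ^ 'n) set \<Rightarrow> bool" where
  "permits_phase_retrieval F \<longleftrightarrow>
     (\<forall>\<psi> \<phi>. (\<forall>v\<in>F. \<bar>v \<bullet> \<psi>\<bar>\<^sup>2 = \<bar>v \<bullet> \<phi>\<bar>\<^sup>2) \<longrightarrow> \<phi> = \<psi> \<or> \<phi> = - \<psi>)"

definition vital :: "(real ^ 'n) set \<Rightarrow> bool" where
  "vital F \<longleftrightarrow> is_frame F \<and> permits_phase_retrieval F \<and>
     (\<forall>v\<in>F. \<not> permits_phase_retrieval (F - {v}))"

(* The coordinates are indexed by a finite type without an order. As vector addition is
   commutative, the pairs i \<noteq> j give the same set of vectors e_i + e_j as the pairs i < j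
   for any numbering of the coordinates by 1, ..., n. *)
definition real_frame :: "(real ^ 'n) set" where
  "real_frame = {axis i 1 | i. True} \<union> {axis i 1 + axis j 1 | i j. i \<noteq> j}"

end

theory Submission
  imports Defs
begin

text \<open>
  Expanding the square \<open>(\<psi>\<^sub>i + \<psi>\<^sub>j)\<^sup>2\<close>, the measurements of a vector \<open>\<psi>\<close> determine exactly the
  products \<open>\<psi>\<^sub>i \<psi>\<^sub>j\<close>, including \<open>i = j\<close>, and these determine \<open>\<psi>\<close> up to sign. Without \<open>e\<^sub>i\<close>, replacing
  the coordinate \<open>0\<close> by \<open>- 2\<close> next to coordinates \<open>1\<close> is not detected; without \<open>e\<^sub>i + e\<^sub>j\<close>, the vectors
  \<open>e\<^sub>i + e\<^sub>j\<close> and \<open>e\<^sub>i - e\<^sub>j\<close> are not distinguished.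
\<close>

lemma axis_nth': "axis i x $ j = (if j = i then x else 0)"
  by (simp add: axis_def)

lemma axis_in_real_frame: "axis i 1 \<in> real_frame"
  by (auto simp: real_frame_def)

lemma axis_add_axis_in_real_frame: "i \<noteq> j \<Longrightarrow> axis i 1 + axis j 1 \<in> real_frame"
  by (auto simp: real_frame_def)

lemma real_frame_cases:
  assumes "v \<in> real_frame"
  obtains i where "v = axis i 1"
  | i j where "i \<noteq> j" "v = axis i 1 + axis j 1"
  using assms by (auto simp: real_frame_def)

lemma is_frame_real_frame: "is_frame (real_frame :: (real ^ 'n) set)"
proof -
  have "real_frame \<subseteq> range (\<lambda>i. axis i 1 :: real ^ 'n) \<union> range (\<lambda>(i, j). axis i 1 + axis j 1)"
    by (auto simp: real_frame_def)
  then have "finite (real_frame :: (real ^ 'n) set)"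
    by (rule finite_subset) simp
  moreover have "Basis \<subseteq> (real_frame :: (real ^ 'n) set)"
    by (auto simp: Basis_vec_def axis_in_real_frame)
  then have "span real_frame = (UNIV :: (real ^ 'n) set)"
    using span_mono span_Basis by blast
  ultimately show ?thesis
    by (simp add: is_frame_def)
qed

lemma permits_phase_retrieval_real_frame:
  "permits_phase_retrieval (real_frame :: (real ^ 'n) set)"
  unfolding permits_phase_retrieval_def
proof (intro allI impI)
  fix \<psi> \<phi> :: "real ^ 'n"
  assume "\<forall>v\<in>real_frame. \<bar>v \<bullet> \<psi>\<bar>\<^sup>2 = \<bar>v \<bullet> \<phi>\<bar>\<^sup>2"
  then have eq: "(v \<bullet> \<psi>)\<^sup>2 = (v \<bullet> \<phi>)\<^sup>2" if "v \<in> real_frame" for v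
    using that by simp
  have sq: "(\<psi> $ i)\<^sup>2 = (\<phi> $ i)\<^sup>2" for i
    using eq[OF axis_in_real_frame[of i]] by (simp add: inner_axis')
  have prod: "\<psi> $ i * \<psi> $ j = \<phi> $ i * \<phi> $ j" for i j
  proof (cases "i = j")
    case True
    then show ?thesis
      using sq[of i] by (simp add: power2_eq_square)
  next
    case False
    then have "(\<psi> $ i + \<psi> $ j)\<^sup>2 = (\<phi> $ i + \<phi> $ j)\<^sup>2"
      using eq[OF axis_add_axis_in_real_frame[of i j]] by (simp add: inner_add_left inner_axis')
    then show ?thesis
      using sq[of i] sq[of j] by (simp add: power2_sum)
  qed
  show "\<phi> = \<psi> \<or> \<phi> = - \<psi>"
  proof (cases "\<psi> = 0")
    case True
    then have "\<phi> $ i = 0" for i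
      using sq[of i] by simp
    then show ?thesis
      using True by (simp add: vec_eq_iff)
  next
    case False
    \<comment> \<open>A nonzero coordinate fixes the global sign: once \<open>\<phi> $ k\<close> is
      known to be plus or minus \<open>\<psi> $ k\<close>, cancelling \<open>\<psi> $ k\<close> in
      the products with index \<open>k\<close> carries the same sign to every coordinate.\<close>
    then obtain k where k: "\<psi> $ k \<noteq> 0"
      by (auto simp: vec_eq_iff)
    from sq[of k] consider "\<phi> $ k = \<psi> $ k" | "\<phi> $ k = - \<psi> $ k"
      by (auto simp: power2_eq_iff)
    then show ?thesis
    proof cases
      case 1
      then have "\<phi> $ j = \<psi> $ j" for j
        using prod[of k j] k by simp
      then show ?thesis
        by (simp add: vec_eq_iff)
    next
      case 2
      then have "\<psi> $ k * \<psi> $ j = \<psi> $ k * - \<phi> $ j" for j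
        using prod[of k j] by simp
      then have "\<phi> $ j = - \<psi> $ j" for j
        using k by (metis mult_left_cancel minus_minus)
      then show ?thesis
        by (simp add: vec_eq_iff)
    qed
  qed
qed

lemma not_permits_phase_retrievalI:
  assumes "\<And>v. v \<in> F \<Longrightarrow> \<bar>v \<bullet> \<psi>\<bar> = \<bar>v \<bullet> \<phi>\<bar>" "\<phi> \<noteq> \<psi>" "\<phi> \<noteq> - \<psi>"
  shows "\<not> permits_phase_retrieval F"
  using assms unfolding permits_phase_retrieval_def by metis

text \<open>Both witnesses give 1 on the other basis vectors and 2 on sums avoiding
  \<open>i\<close>. Sums involving \<open>i\<close> give 1 and -1, and only \<open>axis i 1\<close>
  itself sees the difference, as 0 against -2.\<close>

lemma not_permits_phase_retrieval_remove_axis: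
  "\<not> permits_phase_retrieval (real_frame - {axis i 1 :: real ^ 'n})"
proof (rule not_permits_phase_retrievalI)
  let ?\<psi> = "(\<chi> k. if k = i then 0 else 1) :: real ^ 'n"
  let ?\<phi> = "(\<chi> k. if k = i then - 2 else 1) :: real ^ 'n"
  show "\<bar>v \<bullet> ?\<psi>\<bar> = \<bar>v \<bullet> ?\<phi>\<bar>" if "v \<in> real_frame - {axis i 1}" for v
  proof -
    from that have "v \<in> real_frame" and "v \<noteq> axis i 1" by auto
    then show ?thesis
      by (cases v rule: real_frame_cases) (auto simp: inner_add_left inner_axis')
  qed
  \<comment> \<open>Coordinate \<open>i\<close> settles both claims, since 0 is its own negative;
    this covers dimension 1 as well.\<close>
  show "?\<phi> \<noteq> ?\<psi>" "?\<phi> \<noteq> - ?\<psi>"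
    by (auto simp: vec_eq_iff intro!: exI[of _ i])
qed

text \<open>Flipping the sign of coordinate \<open>j\<close> is visible only to a vector that meets
  both \<open>i\<close> and \<open>j\<close>. The removed vector is the only one in the frame,
  giving 2 against 0.\<close>

lemma not_permits_phase_retrieval_remove_axis_add_axis:
  assumes "i \<noteq> j"
  shows "\<not> permits_phase_retrieval (real_frame - {axis i 1 + axis j 1 :: real ^ 'n})"
proof (rule not_permits_phase_retrievalI)
  let ?\<psi> = "axis i 1 + axis j 1 :: real ^ 'n"
  let ?\<phi> = "axis i 1 - axis j 1 :: real ^ 'n"
  show "\<bar>v \<bullet> ?\<psi>\<bar> = \<bar>v \<bullet> ?\<phi>\<bar>" if "v \<in> real_frame - {?\<psi>}" for v
  proof -
    from that have "v \<in> real_frame" and "v \<noteq> ?\<psi>" by auto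
    then show ?thesis
      using assms
      \<comment> \<open>Commutativity is needed because the excluded vector also arises from the
        swapped pair, as \<open>axis j 1 + axis i 1\<close>.\<close>
      by (cases v rule: real_frame_cases)
        (auto simp: inner_add_left inner_axis' axis_nth' add.commute split: if_splits)
  qed
  have "?\<phi> $ j \<noteq> ?\<psi> $ j" "?\<phi> $ i \<noteq> (- ?\<psi>) $ i"
    using assms by (auto simp: axis_nth')
  then show "?\<phi> \<noteq> ?\<psi>" "?\<phi> \<noteq> - ?\<psi>"
    by metis+
qed

theorem proposition3p2:
  shows "vital (real_frame :: (real ^ 'n) set)"
  unfolding vital_def
proof (intro conjI ballI)
  show "is_frame (real_frame :: (real ^ 'n) set)"
    by (rule is_frame_real_frame)
  show "permits_phase_retrieval (real_frame :: (real ^ 'n) set)"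
    by (rule permits_phase_retrieval_real_frame)
  show "\<not> permits_phase_retrieval (real_frame - {v})" if "v \<in> real_frame" for v :: "real ^ 'n"
    using that
    by (cases v rule: real_frame_cases)
      (simp_all add: not_permits_phase_retrieval_remove_axis
        not_permits_phase_retrieval_remove_axis_add_axis)
qed

end
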